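(* Let $n\ge 1$ and let $k_1,\dots,k_I$ be positive integers with $k_1+\cdots+k_I=n$. Let $\mathcal D(k_1,\dots,k_I)$ be the set of all diagonalizable complex $n\times n$ matrices $A$ which have exactly $I$ distinct eigenvalues, with multiplicities $k_1,\dots,k_I$ (the values of the eigenvalues being otherwise unrestricted). Then the complex dimension of $\mathcal D(k_1,\dots,k_I)$ is $$n^2-\sum_{i=1}^I k_i^2+I \;=\; n^2-\sum_{i=1}^I (k_i^2-1).$$
   Context: $C^{nn}$ denotes the space of complex $n\times n$ matrices, of complex dimension $n^2$. A matrix is diagonalizable if it equals $T\Lambda T^{-1}$ with $T$ invertible and $\Lambda$ diagonal. "Complex dimension" of a subset of $C^{nn}$ is the usual dimension over $\mathbb C$ (of a complex manifold, or of a constructible subset of affine space). *)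

theory Defs
  imports "HOL-Analysis.Analysis" "HOL-Computational_Algebra.Polynomial"
begin

text \<open>
  The space of matrices is \<open>complex^'n^'n\<close>. Notions of several complex variables are set up
  on \<open>complex^'m\<close>, whose complex scalar multiplication is \<open>(*s)\<close>; matrices are identified
  with vectors in \<open>complex^('n \<times> 'n)\<close> by listing their entries.
\<close>

definition mat_to_vec :: "complex^'n^'m \<Rightarrow> complex^('m \<times> 'n)" where
  "mat_to_vec A = (\<chi> ij. A $ fst ij $ snd ij)"

subsection \<open>Complex submanifolds and complex dimension\<close>

text \<open>Holomorphic maps of several variables on an open set: Frechet differentiable at every point
  with a complex-linear derivative.\<close>

definition holomorphic_map_on :: "(complex^'m \<Rightarrow> complex^'k) \<Rightarrow> (complex^'m) set \<Rightarrow> bool" where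
  "holomorphic_map_on f U \<longleftrightarrow>
     (\<forall>x\<in>U. \<exists>f'. Vector_Spaces.linear (*s) (*s) f' \<and> (f has_derivative f') (at x))"

definition biholomorphic ::
  "(complex^'m) set \<Rightarrow> (complex^'k) set \<Rightarrow> (complex^'m \<Rightarrow> complex^'k) \<Rightarrow> (complex^'k \<Rightarrow> complex^'m) \<Rightarrow> bool"
where
  "biholomorphic U V \<phi> \<psi> \<longleftrightarrow> open U \<and> open V \<and>
     holomorphic_map_on \<phi> U \<and> holomorphic_map_on \<psi> V \<and> \<phi> ` U = V \<and> (\<forall>x\<in>U. \<psi> (\<phi> x) = x)"

text \<open>A (locally closed, embedded) complex submanifold, pure of complex dimension \<open>d\<close>: around each of
  its points a biholomorphic change of coordinates of the ambient space straightens it to a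
  complex linear subspace of dimension \<open>d\<close>.\<close>

definition complex_submanifold :: "nat \<Rightarrow> (complex^'m) set \<Rightarrow> bool" where
  "complex_submanifold d M \<longleftrightarrow>
     (\<forall>p\<in>M. \<exists>U V \<phi> \<psi> (L :: (complex^'m) set). p \<in> U \<and> biholomorphic U V \<phi> \<psi> \<and>
        vec.subspace L \<and> vec.dim L = d \<and> \<phi> ` (U \<inter> M) = V \<inter> L)"

text \<open>
  The complex dimension of an arbitrary subset, following Lojasiewicz, Introduction to Complex
  Analytic Geometry: the largest dimension of a nonempty complex submanifold contained in it.
  On a complex submanifold this is its dimension (\<open>complex_dim_submanifold\<close> below), and on a
  constructible set it is the usual algebraic dimension. The supremum is a maximum over a
  subset of \<open>{0..CARD('m)}\<close>; the value is 0 on the empty set.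
\<close>

definition complex_dim :: "(complex^'m) set \<Rightarrow> nat" where
  "complex_dim S = Sup {d. \<exists>M. M \<noteq> {} \<and> M \<subseteq> S \<and> complex_submanifold d M}"

lemma linear_vec_imp_real:
  fixes f :: "complex^'m \<Rightarrow> complex^'k"
  assumes "Vector_Spaces.linear (*s) (*s) f"
  shows "linear f"
proof -
  interpret f: Vector_Spaces.linear "(*s)" "(*s)" f by fact
  have sc: "r *\<^sub>R x = of_real r *s x" for r and x :: "complex^'l"
    by (simp add: vec_eq_iff scaleR_conv_of_real[where 'a=complex])
  show ?thesis
    by (rule linearI) (simp_all add: f.add f.scale sc)
qed

lemma vec_subspace_imp_real:
  fixes L :: "(complex^'m) set"
  assumes "vec.subspace L"
  shows "subspace L"
proof -
  have sc: "r *\<^sub>R x = of_real r *s x" for r and x :: "complex^'m"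
    by (simp add: vec_eq_iff scaleR_conv_of_real[where 'a=complex])
  show ?thesis
    using assms unfolding subspace_def vec.subspace_def by (simp add: sc)
qed

lemma biholomorphic_derivative_inverse:
  assumes b: "biholomorphic U V \<phi> \<psi>" and p: "p \<in> U"
    and f: "(\<phi> has_derivative f) (at p)" and g: "(\<psi> has_derivative g) (at (\<phi> p))"
  shows "g (f x) = x"
proof -
  have "((\<psi> \<circ> \<phi>) has_derivative (g \<circ> f)) (at p)"
    by (rule diff_chain_at[OF f g])
  moreover have "((\<psi> \<circ> \<phi>) has_derivative id) (at p)"
    by (rule has_derivative_transform_within_open[OF has_derivative_id, of U])
       (use b p in \<open>auto simp: biholomorphic_def\<close>)
  ultimately show ?thesis
    using has_derivative_unique by (metis comp_apply id_apply)
qed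

lemma complex_submanifold_dim_mono:
  fixes M N :: "(complex^'m) set"
  assumes M: "complex_submanifold d M" and N: "complex_submanifold e N"
    and "M \<noteq> {}" "M \<subseteq> N"
  shows "d \<le> e"
proof -
  obtain p where p: "p \<in> M" using \<open>M \<noteq> {}\<close> by auto
  with \<open>M \<subseteq> N\<close> have pN: "p \<in> N" by auto
  obtain U V \<phi> \<psi> and L :: "(complex^'m) set" where 1: "p \<in> U" and b: "biholomorphic U V \<phi> \<psi>"
    and L: "vec.subspace L" "vec.dim L = d" and im: "\<phi> ` (U \<inter> M) = V \<inter> L"
    using M p unfolding complex_submanifold_def by metis
  obtain U' V' \<phi>' \<psi>' and L' :: "(complex^'m) set" where pU': "p \<in> U'" and b': "biholomorphic U' V' \<phi>' \<psi>'"
    and L': "vec.subspace L'" "vec.dim L' = e" and im': "\<phi>' ` (U' \<inter> N) = V' \<inter> L'"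
    using N pN unfolding complex_submanifold_def by metis
  define a where "a = \<phi> p"
  have aV: "a \<in> V" "a \<in> L" using im p 1 unfolding a_def by auto
  have pa: "\<psi> a = p" using b 1 unfolding a_def biholomorphic_def by auto
  obtain f where f: "(\<phi> has_derivative f) (at p)"
    using b 1 unfolding biholomorphic_def holomorphic_map_on_def by blast
  obtain g where g: "(\<psi> has_derivative g) (at a)" "Vector_Spaces.linear (*s) (*s) g"
    using b aV unfolding biholomorphic_def holomorphic_map_on_def by blast
  obtain f' where f': "(\<phi>' has_derivative f') (at p)" "Vector_Spaces.linear (*s) (*s) f'"
    using b' pU' unfolding biholomorphic_def holomorphic_map_on_def by blast
  have "\<phi>' p \<in> V'" using b' pU' unfolding biholomorphic_def by auto
  then obtain g' where g': "(\<psi>' has_derivative g') (at (\<phi>' p))"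
    using b' unfolding biholomorphic_def holomorphic_map_on_def by blast
  have gf: "g (f x) = x" for x
    using biholomorphic_derivative_inverse[OF b 1 f] g(1) unfolding a_def by blast
  have inj': "inj f'"
    using biholomorphic_derivative_inverse[OF b' pU' f'(1) g'] by (metis injI)
  have "surj g" using gf by (metis surj_def)
  then have injg: "inj g"
    using linear_vec_imp_real[OF g(2)] by (simp add: linear_surjective_imp_injective)
  define h where "h = f' \<circ> g"
  have linh: "Vector_Spaces.linear (*s) (*s) h"
    unfolding h_def by (rule Vector_Spaces.linear_compose[OF g(2) f'(2)])
  have injh: "inj h" unfolding h_def using inj' injg by (rule inj_compose)
  have dh: "((\<phi>' \<circ> \<psi>) has_derivative h) (at a)"
    unfolding h_def by (rule diff_chain_at[OF g(1)]) (simp add: pa f'(1))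
  have realL: "subspace L" "subspace L'"
    using L(1) L'(1) by (simp_all add: vec_subspace_imp_real)
  have opV: "open V" and opU': "open U'" using b b' unfolding biholomorphic_def by auto
  have cont: "isCont \<psi> a" using g(1) has_derivative_continuous by blast
  have inL': "\<phi>' (\<psi> y) \<in> L'" if y: "y \<in> V \<inter> L" "\<psi> y \<in> U'" for y
  proof -
    obtain x where x: "x \<in> U \<inter> M" "y = \<phi> x" using y(1) im by auto
    then have "\<psi> y = x" using b unfolding biholomorphic_def by auto
    then show ?thesis using x y(2) im' \<open>M \<subseteq> N\<close> by blast
  qed
  have hL: "h v \<in> L'" if v: "v \<in> L" for v
  proof -
    define c where "c = (\<lambda>t::real. a + t *\<^sub>R v)"
    have c0: "c 0 = a" by (simp add: c_def)
    have cL: "c t \<in> L" for t unfolding c_def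
      using realL(1) aV(2) v by (simp add: subspace_add subspace_scale)
    have cderiv: "(c has_vector_derivative v) (at 0)"
      unfolding c_def by (auto intro!: derivative_eq_intros)
    have tc: "(c \<longlongrightarrow> a) (at 0)"
      using cderiv c0 by (metis has_vector_derivative_continuous isContD)
    have ev1: "eventually (\<lambda>t. c t \<in> V) (at 0)"
      using topological_tendstoD[OF tc opV aV(1)] .
    have "((\<lambda>t. \<psi> (c t)) \<longlongrightarrow> \<psi> a) (at 0)"
      using isCont_tendsto_compose[OF cont tc] .
    then have ev2: "eventually (\<lambda>t. \<psi> (c t) \<in> U') (at 0)"
      using topological_tendstoD[OF _ opU'] pU' pa by metis
    have D: "((\<lambda>t. \<phi>' (\<psi> (c t))) has_vector_derivative h v) (at 0)"
    proof -
      have "((\<phi>' \<circ> \<psi>) \<circ> c has_derivative h \<circ> (\<lambda>t. t *\<^sub>R v)) (at 0)"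
        by (rule diff_chain_at) (use cderiv dh c0 in \<open>auto simp: has_vector_derivative_def\<close>)
      moreover have "h \<circ> (\<lambda>t. t *\<^sub>R v) = (\<lambda>t. t *\<^sub>R h v)"
        using linear_vec_imp_real[OF linh] by (auto simp: linear_scale)
      ultimately show ?thesis
        by (simp add: has_vector_derivative_def comp_def)
    qed
    have lim: "((\<lambda>t. (1 / t) *\<^sub>R (\<phi>' (\<psi> (c t)) - \<phi>' (\<psi> a))) \<longlongrightarrow> h v) (at 0)"
    proof (rule Lim_transform[OF tendsto_const])
      let ?E = "\<lambda>t::real. \<phi>' (\<psi> (c t)) - (\<phi>' (\<psi> a) + t *\<^sub>R h v)"
      have "((\<lambda>t. (1 / \<bar>t\<bar>) *\<^sub>R ?E t) \<longlongrightarrow> 0) (at 0)"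
        using D by (simp add: has_vector_derivative_def has_derivative_within c0)
      then have "((\<lambda>t. norm ((1 / t) *\<^sub>R ?E t)) \<longlongrightarrow> 0) (at 0)"
        by (drule_tac tendsto_norm_zero) simp
      then have "((\<lambda>t. (1 / t) *\<^sub>R ?E t) \<longlongrightarrow> 0) (at 0)"
        by (rule tendsto_norm_zero_cancel)
      then show "((\<lambda>t. (1 / t) *\<^sub>R (\<phi>' (\<psi> (c t)) - \<phi>' (\<psi> a)) - h v) \<longlongrightarrow> 0) (at 0)"
        by (rule Lim_transform_eventually)
           (auto simp: eventually_at_filter scaleR_diff_right scaleR_add_right)
    qed
    have "a \<in> V \<inter> L" "\<psi> a \<in> U'" using aV pa pU' by auto
    then have a': "\<phi>' (\<psi> a) \<in> L'" by (rule inL')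
    have "eventually (\<lambda>t. (1 / t) *\<^sub>R (\<phi>' (\<psi> (c t)) - \<phi>' (\<psi> a)) \<in> L') (at 0)"
    proof (rule eventually_mono[OF eventually_conj[OF ev1 ev2]])
      fix t assume "c t \<in> V \<and> \<psi> (c t) \<in> U'"
      then have "\<phi>' (\<psi> (c t)) \<in> L'" using inL' cL by blast
      then show "(1 / t) *\<^sub>R (\<phi>' (\<psi> (c t)) - \<phi>' (\<psi> a)) \<in> L'"
        using realL(2) a' by (intro subspace_scale subspace_diff)
    qed
    then show ?thesis
      using Lim_in_closed_set[OF closed_subspace[OF realL(2)] _ _ lim] by simp
  qed
  have "vec.dim (h ` L) = vec.dim L"
    by (rule vec.dim_image_eq[OF linh]) (use injh in \<open>simp add: inj_on_def\<close>)
  moreover have "vec.dim (h ` L) \<le> vec.dim L'"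
    by (rule vec.dim_subset) (use hL in auto)
  ultimately show ?thesis using L L' by simp
qed

lemma complex_dim_submanifold:
  assumes "complex_submanifold d M" "M \<noteq> {}"
  shows "complex_dim M = d"
  unfolding complex_dim_def
  by (rule cSup_eq_maximum) (use assms complex_submanifold_dim_mono in blast)+

subsection \<open>Diagonalizable matrices with prescribed multiplicities\<close>

definition diagonalizable :: "complex^'n^'n \<Rightarrow> bool" where
  "diagonalizable A \<longleftrightarrow> (\<exists>(T :: complex^'n^'n) (\<Lambda> :: complex^'n^'n). invertible T \<and> (\<forall>i j. i \<noteq> j \<longrightarrow> \<Lambda> $ i $ j = 0) \<and>
      A = T ** \<Lambda> ** matrix_inv T)"

definition eigenvalues :: "complex^'n^'n \<Rightarrow> complex set" where
  "eigenvalues A = {x. \<exists>v. v \<noteq> 0 \<and> A *v v = x *s v}"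

definition charpoly :: "complex^'n^'n \<Rightarrow> complex poly" where
  "charpoly A = det (\<chi> i j. (if i = j then [:0, 1:] else 0) - [:A $ i $ j:])"

definition diagonalizable_mult :: "nat \<Rightarrow> (nat \<Rightarrow> nat) \<Rightarrow> (complex^'n^'n) set" where
  "diagonalizable_mult I k =
     {A. diagonalizable A \<and>
         (\<exists>ev. bij_betw ev {1..I} (eigenvalues A) \<and> (\<forall>i\<in>{1..I}. order (ev i) (charpoly A) = k i))}"

end

theory Submission
  imports Defs
begin

text \<open>
  The set is itself a complex submanifold. Take a member \<open>T \<Lambda> T\<inverse>\<close> and group equal entries of the
  diagonal matrix \<open>\<Lambda>\<close> into blocks. The map
  \<open>(X, B) \<mapsto> T (1 + X) B (1 + X)\<inverse> T\<inverse>\<close>, for \<open>B\<close> block diagonal and \<open>X\<close> vanishing on the blocks, has at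
  \<open>(0, \<Lambda>)\<close> the derivative \<open>(X, B) \<mapsto> T (X \<Lambda> - \<Lambda> X + B) T\<inverse>\<close>, which is bijective because distinct blocks
  carry distinct eigenvalues. By the inverse function theorem it is a local chart. Near \<open>(0, \<Lambda>)\<close>
  the blocks of \<open>B\<close> have disjoint spectra, so its image lies in the set exactly when every block
  of \<open>B\<close> is scalar. These conditions cut out a linear subspace with \<open>n\<^sup>2 - \<Sum> k\<^sub>i\<^sup>2\<close> free entries
  off the blocks and one for each of the \<open>I\<close> blocks.
\<close>

subsection \<open>Diagonalization with labelled eigenvalues\<close>

definition diag_mat :: "('n \<Rightarrow> 'a::zero) \<Rightarrow> 'a^'n^'n" where
  "diag_mat d = (\<chi> i j. if i = j then d i else 0)"

lemma diag_mat_nth [simp]: "diag_mat d $ i $ j = (if i = j then d i else 0)"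
  by (simp add: diag_mat_def)

lemma diag_mat_mult_nth:
  fixes A :: "'a::semiring_1^'n^'n"
  shows "(diag_mat d ** A) $ i $ j = d i * A $ i $ j"
  by (simp add: matrix_matrix_mult_def if_distrib if_distribR cong: if_cong)

lemma mult_diag_mat_nth:
  fixes A :: "'a::semiring_1^'n^'n"
  shows "(A ** diag_mat d) $ i $ j = A $ i $ j * d j"
  by (simp add: matrix_matrix_mult_def if_distrib if_distribR cong: if_cong)

lemma diag_mat_mult_vec_nth:
  fixes v :: "'a::semiring_1^'n"
  shows "(diag_mat d *v v) $ i = d i * v $ i"
  by (simp add: matrix_vector_mult_def if_distrib if_distribR cong: if_cong)

lemma matrix_inv_mult:
  fixes T :: "'a::semiring_1^'n^'n"
  assumes "invertible T"
  shows "T ** matrix_inv T = mat 1" "matrix_inv T ** T = mat 1"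
  using someI_ex[OF assms[unfolded invertible_def]] unfolding matrix_inv_def by auto

lemma invertible_matrix_inv:
  fixes T :: "'a::semiring_1^'n^'n"
  assumes "invertible T"
  shows "invertible (matrix_inv T)"
  using matrix_inv_mult[OF assms] unfolding invertible_def by blast

text \<open>Gives access to the intertwining relation \<open>A ** T = T ** B\<close>, which for
  diagonal \<open>B\<close> says that the columns of \<open>T\<close> are eigenvectors of
  \<open>A\<close>.\<close>

lemma eq_conjugate_iff:
  fixes T :: "'a::field^'n^'n"
  assumes "invertible T"
  shows "A = T ** B ** matrix_inv T \<longleftrightarrow> A ** T = T ** B"
proof
  assume "A = T ** B ** matrix_inv T"
  then have "A ** T = T ** B ** (matrix_inv T ** T)" by (simp add: matrix_mul_assoc)
  then show "A ** T = T ** B" by (simp add: matrix_inv_mult[OF assms])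
next
  assume "A ** T = T ** B"
  then have "T ** B ** matrix_inv T = A ** (T ** matrix_inv T)" by (simp add: matrix_mul_assoc)
  then show "A = T ** B ** matrix_inv T" by (simp add: matrix_inv_mult[OF assms])
qed

text \<open>\<open>T\<close> carries eigenvectors of the diagonal matrix to eigenvectors of
  \<open>A\<close>, and its inverse carries them back; the basis vectors \<open>axis j 1\<close>
  realise every \<open>d j\<close>.\<close>

lemma eigenvalues_conjugate_diag:
  fixes T :: "complex^'n^'n"
  assumes T: "invertible T" and A: "A = T ** diag_mat d ** matrix_inv T"
  shows "eigenvalues A = range d"
proof -
  have AT: "A ** T = T ** diag_mat d"
    using A eq_conjugate_iff[OF T] by blast
  show ?thesis
  proof (intro set_eqI iffI)
    fix x assume "x \<in> eigenvalues A"
    then obtain v where v: "v \<noteq> 0" "A *v v = x *s v"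
      unfolding eigenvalues_def by auto
    define w where "w = matrix_inv T *v v"
    have Tw: "T *v w = v"
      by (simp add: w_def matrix_vector_mul_assoc matrix_inv_mult[OF T])
    have "T *v (diag_mat d *v w) = A *v (T *v w)"
      by (simp add: matrix_vector_mul_assoc AT)
    then have "T *v (diag_mat d *v w) = T *v (x *s w)"
      by (simp add: Tw v(2) vector_scalar_commute)
    then have eq: "diag_mat d *v w = x *s w"
      by (rule injD[OF inj_matrix_vector_mult[OF T]])
    have "w \<noteq> 0" using Tw v(1) by auto
    then obtain i where "w $ i \<noteq> 0" by (auto simp: vec_eq_iff)
    moreover have "d i * w $ i = x * w $ i"
      using arg_cong[OF eq, of "\<lambda>u. u $ i"]
      by (simp add: diag_mat_mult_vec_nth)
    ultimately show "x \<in> range d" by auto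
  next
    fix x assume "x \<in> range d"
    then obtain j where j: "x = d j" by auto
    have "A *v (T *v axis j 1) = x *s (T *v axis j 1)"
    proof -
      have "diag_mat d *v axis j 1 = x *s axis j 1"
        by (simp add: vec_eq_iff diag_mat_mult_vec_nth axis_def j)
      moreover have "A *v (T *v axis j 1) = T *v (diag_mat d *v axis j 1)"
        by (simp only: matrix_vector_mul_assoc AT)
      ultimately show ?thesis by (simp add: vector_scalar_commute)
    qed
    moreover have "T *v axis j 1 \<noteq> 0"
      using injD[OF inj_matrix_vector_mult[OF T], of "axis j 1" 0] by auto
    ultimately show "x \<in> eigenvalues A" unfolding eigenvalues_def by blast
  qed
qed

text \<open>The conjugation is carried out over the polynomial ring, with \<open>T\<close> and its
  inverse lifted to constant matrices. The scalar matrix \<open>X\<close> is central, so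
  \<open>lift T\<close> intertwines \<open>X - lift A\<close> with its diagonal counterpart, and
  determinants can be compared.\<close>

lemma charpoly_conjugate_diag:
  fixes T :: "complex^'n^'n"
  assumes T: "invertible T" and A: "A = T ** diag_mat d ** matrix_inv T"
  shows "charpoly A = (\<Prod>i\<in>UNIV. [:- d i, 1:])"
proof -
  define lift :: "complex^'n^'n \<Rightarrow> complex poly^'n^'n" where "lift M = (\<chi> i j. [:M $ i $ j:])" for M
  define X :: "complex poly^'n^'n" where "X = diag_mat (\<lambda>_. [:0, 1:])"
  have sum_const: "(\<Sum>l\<in>L. [:f l:]) = [:sum f L:]" for f :: "'n \<Rightarrow> complex" and L
    by (induction L rule: infinite_finite_induct) auto
  have lift_mult: "lift (M ** N) = lift M ** lift N" for M N
    by (simp add: lift_def vec_eq_iff matrix_matrix_mult_def mult.commute flip: sum_const)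
  have lift_1: "lift (mat 1) = mat 1"
    by (simp add: lift_def vec_eq_iff mat_def)
  have comm: "X ** M = M ** X" for M
    by (simp add: vec_eq_iff X_def diag_mat_mult_nth mult_diag_mat_nth mult.commute)
  have charp: "charpoly M = det (X - lift M)" for M
    unfolding charpoly_def X_def lift_def diag_mat_def
    by (rule arg_cong[of _ _ det]) (simp add: vec_eq_iff)
  have "(X - lift A) ** lift T = lift T ** (X - lift (diag_mat d))"
  proof -
    have "lift A ** lift T = lift T ** lift (diag_mat d)"
      using A by (simp add: eq_conjugate_iff[OF T] flip: lift_mult)
    moreover have "(M - N) ** K = M ** K - N ** K" "K ** (M - N) = K ** M - K ** N"
      for M N K :: "complex poly^'n^'n"
      by (simp_all add: vec_eq_iff matrix_matrix_mult_def algebra_simps sum_subtractf)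
    ultimately show ?thesis by (simp add: comm)
  qed
  from arg_cong[OF this, of det]
  have "det (X - lift A) * det (lift T) = det (X - lift (diag_mat d)) * det (lift T)"
    by (simp add: det_mul mult.commute)
  \<comment> \<open>Polynomials form an integral domain, so a nonzero determinant can be
    cancelled.\<close>
  moreover have "det (lift T) * det (lift (matrix_inv T)) = 1"
    by (simp add: matrix_inv_mult[OF T] lift_1 flip: det_mul lift_mult)
  then have "det (lift T) \<noteq> 0" by auto
  ultimately have "charpoly A = det (X - lift (diag_mat d))"
    by (simp add: charp)
  also have "\<dots> = (\<Prod>i\<in>UNIV. [:- d i, 1:])"
    by (subst det_diagonal) (simp_all add: X_def lift_def)
  finally show ?thesis .
qed

lemma order_prod_linear_factors:
  fixes d :: "'b \<Rightarrow> 'a::idom"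
  assumes "finite S"
  shows "order x (\<Prod>i\<in>S. [:- d i, 1:]) = card {i\<in>S. d i = x}"
  using assms
proof (induction S rule: finite_induct)
  case (insert i S)
  have nz: "[:- d i, 1:] * (\<Prod>i\<in>S. [:- d i, 1:]) \<noteq> 0"
    using insert.hyps by (subst mult_eq_0_iff) (simp add: prod_zero_iff)
  have "order x [:- d i, 1:] = (if d i = x then 1 else 0)"
    using order_power_n_n[of x 1] by (auto intro: order_0I)
  moreover have "{j\<in>insert i S. d j = x} = (if d i = x then insert i {j\<in>S. d j = x} else {j\<in>S. d j = x})"
    by auto
  ultimately show ?case
    using insert by (simp add: order_mult[OF nz] del: mult_pCons_left)
qed simp

text \<open>\<open>b\<close> assigns to each position of the diagonal the index of the eigenvalue standing there.\<close>

definition labelling :: "nat \<Rightarrow> (nat \<Rightarrow> nat) \<Rightarrow> ('n::finite \<Rightarrow> nat) \<Rightarrow> bool" where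
  "labelling I k b \<longleftrightarrow> range b = {1..I} \<and> (\<forall>m\<in>{1..I}. card (b -` {m}) = k m)"

text \<open>Replaces root orders by counting: once \<open>A\<close> is diagonalized, the order of an
  eigenvalue is the number of diagonal positions where it stands. This form of membership is the one
  used for the charts.\<close>

lemma diagonalizable_mult_iff:
  fixes A :: "complex^'n^'n"
  shows "A \<in> diagonalizable_mult I k \<longleftrightarrow>
    (\<exists>(T :: complex^'n^'n) b c. invertible T \<and> labelling I k b \<and> inj_on c {1..I} \<and>
       A = T ** diag_mat (c \<circ> b) ** matrix_inv T)"
proof
  assume "A \<in> diagonalizable_mult I k"
  then obtain T \<Lambda> :: "complex^'n^'n" and ev where T: "invertible T" and \<Lambda>: "\<forall>i j. i \<noteq> j \<longrightarrow> \<Lambda> $ i $ j = 0"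
    and A: "A = T ** \<Lambda> ** matrix_inv T" and ev: "bij_betw ev {1..I} (eigenvalues A)"
    and ord: "\<forall>i\<in>{1..I}. order (ev i) (charpoly A) = k i"
    unfolding diagonalizable_mult_def diagonalizable_def by blast
  define d where "d i = \<Lambda> $ i $ i" for i
  have "\<Lambda> = diag_mat d"
    using \<Lambda> by (simp add: vec_eq_iff d_def)
  with A have A': "A = T ** diag_mat d ** matrix_inv T" by simp
  note E = eigenvalues_conjugate_diag[OF T A']
  \<comment> \<open>The label of a position is the index of its diagonal entry in the enumeration
    \<open>ev\<close> of the eigenvalues.\<close>
  define b where "b i = inv_into {1..I} ev (d i)" for i
  have d_im: "d i \<in> ev ` {1..I}" for i
    using ev E by (simp add: bij_betw_def)
  have evb: "b i \<in> {1..I}" "ev (b i) = d i" for i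
    unfolding b_def using d_im[of i] by (rule inv_into_into, rule f_inv_into_f)
  have bev: "d i = ev m \<longleftrightarrow> b i = m" if "m \<in> {1..I}" for i m
    using ev evb[of i] that unfolding bij_betw_def by (metis inj_onD)
  have "card (b -` {m}) = k m" if "m \<in> {1..I}" for m
  proof -
    have "k m = card {i \<in> UNIV. d i = ev m}"
      using ord that charpoly_conjugate_diag[OF T A'] order_prod_linear_factors[of UNIV "ev m" d]
      by simp
    also have "{i \<in> UNIV. d i = ev m} = b -` {m}"
      using bev that by auto
    finally show ?thesis ..
  qed
  moreover have "range b = {1..I}"
  proof
    show "range b \<subseteq> {1..I}" using evb by auto
    show "{1..I} \<subseteq> range b"
    proof
      fix m assume m: "m \<in> {1..I}"
      then have "ev m \<in> range d" using ev E by (auto simp: bij_betw_def)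
      then obtain i where "d i = ev m" by auto
      then show "m \<in> range b" using bev[OF m] by auto
    qed
  qed
  ultimately have "labelling I k b" by (simp add: labelling_def)
  moreover have "A = T ** diag_mat (ev \<circ> b) ** matrix_inv T" using evb A' by (simp add: comp_def)
  moreover have "inj_on ev {1..I}" using ev by (simp add: bij_betw_def)
  ultimately show "\<exists>(T :: complex^'n^'n) b c. invertible T \<and> labelling I k b \<and> inj_on c {1..I} \<and>
       A = T ** diag_mat (c \<circ> b) ** matrix_inv T"
    using T by (intro exI conjI)
next
  assume "\<exists>(T :: complex^'n^'n) b c. invertible T \<and> labelling I k b \<and> inj_on c {1..I} \<and>
       A = T ** diag_mat (c \<circ> b) ** matrix_inv T"
  then obtain T :: "complex^'n^'n" and b :: "'n \<Rightarrow> nat" and c where T: "invertible T" and b: "labelling I k b" and c: "inj_on c {1..I}"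
    and A: "A = T ** diag_mat (c \<circ> b) ** matrix_inv T" by blast
  have rb: "range b = {1..I}" using b by (simp add: labelling_def)
  have "bij_betw c {1..I} (eigenvalues A)"
    using c unfolding bij_betw_def eigenvalues_conjugate_diag[OF T A] rb[symmetric] by (simp add: image_comp)
  moreover have "order (c m) (charpoly A) = k m" if "m \<in> {1..I}" for m
  proof -
    have "{i \<in> UNIV. (c \<circ> b) i = c m} = b -` {m}"
    proof -
      have "b i \<in> {1..I}" for i using rb by auto
      then have "c (b i) = c m \<longleftrightarrow> b i = m" for i
        using inj_on_eq_iff[OF c] that by metis
      then show ?thesis by auto
    qed
    then show ?thesis
      using b that charpoly_conjugate_diag[OF T A] order_prod_linear_factors[of UNIV "c m" "c \<circ> b"]
      unfolding labelling_def by simp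
  qed
  moreover have "diagonalizable A"
    unfolding diagonalizable_def using T A by (intro exI conjI) auto
  ultimately show "A \<in> diagonalizable_mult I k"
    unfolding diagonalizable_mult_def by (intro CollectI conjI exI ballI)
qed

section \<open>Existence of labellings and of members of the set\<close>

lemma labelling_exists:
  assumes k: "\<And>i. i \<in> {1..I} \<Longrightarrow> k i > 0" and sum: "(\<Sum>i=1..I. k i) = CARD('n)"
  obtains b :: "'n::finite \<Rightarrow> nat" where "labelling I k b"
proof -
  \<comment> \<open>A disjoint union of model blocks of sizes \<open>k i\<close> has as many
    elements as there are positions, so a bijection \<open>h\<close> onto it transports the block
    index.\<close>
  define S where "S = Sigma {1..I} (\<lambda>i. {..<k i})"
  have "card S = CARD('n)" "finite S"
    using sum by (simp_all add: S_def)
  then obtain h where h: "bij_betw h (UNIV :: 'n set) S"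
    using finite_same_card_bij[of "UNIV :: 'n set" S] by auto
  have im: "range h = S" and inj: "inj h" using h unfolding bij_betw_def by auto
  have "fst ` S = {1..I}"
    unfolding S_def using k by force
  then have "range (fst \<circ> h) = {1..I}"
    using im by (metis image_comp)
  moreover have "card ((fst \<circ> h) -` {m}) = k m" if "m \<in> {1..I}" for m
  proof -
    have "h ` ((fst \<circ> h) -` {m}) = {m} \<times> {..<k m}"
    proof -
      have "h ` ((fst \<circ> h) -` {m}) = {p \<in> S. fst p = m}" using im by auto
      also have "\<dots> = {m} \<times> {..<k m}" using that by (auto simp: S_def)
      finally show ?thesis .
    qed
    then have "card (h ` ((fst \<circ> h) -` {m})) = k m" by (simp add: card_cartesian_product)
    then show ?thesis using card_image[OF inj_on_subset[OF inj subset_UNIV]] by metis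
  qed
  ultimately show ?thesis using that unfolding labelling_def by blast
qed

lemma diagonalizable_mult_nonempty:
  assumes "\<And>i. i \<in> {1..I} \<Longrightarrow> k i > 0" and "(\<Sum>i=1..I. k i) = CARD('n)"
  shows "(diagonalizable_mult I k :: (complex^'n^'n) set) \<noteq> {}"
proof -
  obtain b :: "'n \<Rightarrow> nat" where b: "labelling I k b"
    using labelling_exists[OF assms] by auto
  \<comment> \<open>Block \<open>m\<close> receives the number \<open>m\<close> as its eigenvalue,
    which makes the eigenvalues distinct.\<close>
  define A :: "complex^'n^'n" where "A = mat 1 ** diag_mat (of_nat \<circ> b) ** matrix_inv (mat 1)"
  have "invertible (mat 1 :: complex^'n^'n)" by (auto simp: invertible_def)
  moreover have "inj_on (of_nat :: nat \<Rightarrow> complex) {1..I}" by (simp add: inj_on_def)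
  ultimately have "A \<in> diagonalizable_mult I k"
    unfolding diagonalizable_mult_iff using A_def b by blast
  then show ?thesis by auto
qed

subsection \<open>The holomorphic inverse function theorem and matrix inversion\<close>

lemma bounded_bilinear_matrix_mult:
  "bounded_bilinear ((**) :: complex^'n^'m \<Rightarrow> complex^'p^'n \<Rightarrow> complex^'p^'m)"
  unfolding bilinear_conv_bounded_bilinear[symmetric] bilinear_def linear_iff
  by (simp add: vec_eq_iff matrix_matrix_mult_def algebra_simps sum.distrib scaleR_sum_right)

interpretation matrix_mult: bounded_bilinear
  "(**) :: complex^'n^'m \<Rightarrow> complex^'p^'n \<Rightarrow> complex^'p^'m"
  by (rule bounded_bilinear_matrix_mult)

lemma continuous_on_det [continuous_intros]:
  fixes f :: "'b::topological_space \<Rightarrow> complex^'n^'n"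
  assumes "continuous_on S f"
  shows "continuous_on S (\<lambda>x. det (f x))"
  unfolding det_def using assms by (intro continuous_intros)

lemma open_invertible: "open {A :: complex^'n^'n. invertible A}"
proof -
  have "open {A :: complex^'n^'n. det A \<noteq> 0}"
    by (intro open_Collect_neq continuous_intros)
  then show ?thesis by (simp add: invertible_det_nz)
qed

text \<open>Each column of the inverse solves a linear system, so by Cramer's rule the entries are
  quotients of determinants, continuous in the entries of \<open>A\<close>.\<close>

lemma continuous_on_matrix_inv:
  "continuous_on {A :: complex^'n^'n. invertible A} matrix_inv"
proof -
  have entry: "matrix_inv A $ i $ j =
      det (\<chi> p q. if q = i then (if p = j then 1 else 0) else A $ p $ q) / det A"
    if "invertible A" for A :: "complex^'n^'n" and i j
  proof -
    have "A *v column j (matrix_inv A) = axis j 1"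
    proof -
      have "A *v column j (matrix_inv A) = column j (A ** matrix_inv A)"
        by (simp add: vec_eq_iff matrix_vector_mult_def matrix_matrix_mult_def column_def)
      then show ?thesis
        by (simp add: matrix_inv_mult[OF that] vec_eq_iff column_def mat_def axis_def)
    qed
    then have "column j (matrix_inv A) =
        (\<chi> k. det (\<chi> p q. if q = k then axis j 1 $ p else A $ p $ q) / det A)"
      using cramer that invertible_det_nz by blast
    from arg_cong[OF this, of "\<lambda>v. v $ i"] show ?thesis
      by (simp add: column_def axis_def if_distrib cong: if_cong)
  qed
  have "continuous_on {A :: complex^'n^'n. invertible A} (\<lambda>A. \<chi> i j.
      det (\<chi> p q. if q = i then (if p = j then 1 else 0) else A $ p $ q) / det A)"
  proof (intro continuous_intros)
    show "continuous_on {A. invertible A}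
        (\<lambda>A. if q = i then if p = j then 1 else 0 else A $ p $ q)" for p q i j :: 'n
      by (cases "q = i") (auto intro!: continuous_intros)
  qed (simp add: invertible_det_nz)
  then show ?thesis
    by (rule continuous_on_cong[THEN iffD1, rotated -1]) (simp_all add: vec_eq_iff entry)
qed

text \<open>With \<open>Q = matrix_inv\<close>, the identity
  \<open>Q A - Q B = Q B ** (B - A) ** Q A\<close> turns the remainder into
  \<open>(Q A - Q B) ** (B - A) ** Q A\<close>. Its first factor tends to 0 by continuity of
  inversion, so the remainder is of smaller order than \<open>B - A\<close>.\<close>

lemma has_derivative_matrix_inv:
  fixes A :: "complex^'n^'n"
  assumes A: "invertible A"
  shows "(matrix_inv has_derivative (\<lambda>H. - (matrix_inv A ** H ** matrix_inv A))) (at A)"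
proof -
  let ?Q = "matrix_inv :: complex^'n^'n \<Rightarrow> complex^'n^'n"
  obtain K where K: "\<And>(M :: complex^'n^'n) (N :: complex^'n^'n). norm (M ** N) \<le> norm M * norm N * K" "K > 0"
    using matrix_mult.pos_bounded by blast
  have lim0: "(?Q \<longlongrightarrow> ?Q A) (at A)"
    using continuous_on_matrix_inv A open_invertible
    by (metis (no_types, lifting) continuous_on_eq_continuous_at isContD mem_Collect_eq)
  have "((\<lambda>B. norm (?Q B - ?Q A - - (?Q A ** (B - A) ** ?Q A)) / norm (B - A)) \<longlongrightarrow> 0) (at A)"
  \<comment> \<open>The norm is submultiplicative up to the factor \<open>K\<close>, which enters
    once for each of the two products.\<close>
  proof (rule tendsto_0_le[where K = "K * norm (?Q A) * K"])
    show "((\<lambda>B. norm (?Q A - ?Q B)) \<longlongrightarrow> 0) (at A)"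
      using tendsto_norm[OF tendsto_diff[OF tendsto_const[of "?Q A"] lim0]] by simp
    show "\<forall>\<^sub>F B in at A. norm (norm (?Q B - ?Q A - - (?Q A ** (B - A) ** ?Q A)) / norm (B - A))
        \<le> norm (norm (?Q A - ?Q B)) * (K * norm (?Q A) * K)"
    proof -
      have "\<forall>\<^sub>F B in at A. invertible B \<and> B \<noteq> A"
        using open_invertible A eventually_at_topological by blast
      then show ?thesis
      proof eventually_elim
        case (elim B)
        have "?Q B ** (B - A) ** ?Q A = ?Q A - ?Q B"
        proof -
          have "?Q B ** (B - A) ** ?Q A = ?Q B ** B ** ?Q A - ?Q B ** (A ** ?Q A)"
            by (simp add: matrix_mult.diff_left matrix_mult.diff_right matrix_mul_assoc)
          then show ?thesis using elim A by (simp add: matrix_inv_mult)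
        qed
        then have "?Q B - ?Q A - - (?Q A ** (B - A) ** ?Q A) = (?Q A - ?Q B) ** (B - A) ** ?Q A"
          by (simp add: matrix_mult.diff_left algebra_simps)
        moreover have "norm ((?Q A - ?Q B) ** (B - A) ** ?Q A)
            \<le> norm (?Q A - ?Q B) * norm (B - A) * K * norm (?Q A) * K"
          by (rule order_trans[OF K(1)]) (intro mult_right_mono K(1) norm_ge_zero less_imp_le[OF K(2)])
        ultimately show ?case using elim
          by (simp add: divide_le_eq mult_ac)
      qed
    qed
  qed
  moreover have "bounded_linear (\<lambda>H. - (?Q A ** H ** ?Q A))"
    by (intro bounded_linear_minus bounded_linear_compose[OF matrix_mult.bounded_linear_left]
        matrix_mult.bounded_linear_right)
  ultimately show ?thesis
    by (simp add: has_derivative_iff_norm)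
qed

lemma has_derivative_conjugate:
  fixes S B :: "'b::real_normed_vector \<Rightarrow> complex^'n^'n"
  assumes S: "(S has_derivative S') (at x)" and B: "(B has_derivative B') (at x)"
    and inv: "invertible (S x)"
  defines "Q \<equiv> matrix_inv (S x)"
  shows "((\<lambda>y. S y ** B y ** matrix_inv (S y)) has_derivative
    (\<lambda>h. S x ** B x ** - (Q ** S' h ** Q) + (S x ** B' h + S' h ** B x) ** Q)) (at x)"
proof -
  have "((\<lambda>y. matrix_inv (S y)) has_derivative (\<lambda>h. - (Q ** S' h ** Q))) (at x)"
    using diff_chain_at[OF S has_derivative_matrix_inv[OF inv]] by (simp add: comp_def Q_def)
  from matrix_mult.FDERIV[OF matrix_mult.FDERIV[OF S B] this] show ?thesis
    unfolding Q_def by simp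
qed

text \<open>Reduces to the real theorem: the derivative of the local inverse is the inverse of a
  complex-linear bijection, hence complex-linear. In finite dimension, injectivity at
  \<open>x0\<close> already gives invertibility, and continuity of \<open>f'\<close> in each
  direction gives continuity in operator norm.\<close>

lemma holomorphic_inverse_function_theorem:
  fixes f :: "complex^'m \<Rightarrow> complex^'m"
  assumes U: "open U" "x0 \<in> U"
    and der: "\<And>x. x \<in> U \<Longrightarrow> (f has_derivative f' x) (at x)"
    and lin: "\<And>x. x \<in> U \<Longrightarrow> Vector_Spaces.linear (*s) (*s) (f' x)"
    and cont: "\<And>h. continuous_on U (\<lambda>x. f' x h)"
    and ker: "\<And>h. f' x0 h = 0 \<Longrightarrow> h = 0"
  obtains U' V g where "x0 \<in> U'" "U' \<subseteq> U" "biholomorphic U' V f g" "biholomorphic V U' g f"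
proof -
  define F where "F x = Blinfun (f' x)" for x
  have F: "blinfun_apply (F x) = f' x" if "x \<in> U" for x
    unfolding F_def using der[OF that] by (simp add: bounded_linear_Blinfun_apply has_derivative_bounded_linear)
  have linx0: "linear (f' x0)" using lin U linear_vec_imp_real by blast
  have "inj (f' x0)" using ker by (simp add: linear_injective_0[OF linx0])
  then obtain G where G: "linear G" "\<And>h. G (f' x0 h) = h"
    using linear_injective_left_inverse[OF linx0] by (metis comp_apply id_apply)
  have "bounded_linear G" using G(1) by (simp add: linear_conv_bounded_linear)
  then have inv: "Blinfun G o\<^sub>L F x0 = id_blinfun"
    by (intro blinfun_eqI) (simp add: F U G bounded_linear_Blinfun_apply)
  have contF: "continuous_on U F"
  proof (rule continuous_on_blinfun_componentwise)
    fix i :: "complex^'m" assume "i \<in> Basis"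
    show "continuous_on U (\<lambda>x. blinfun_apply (F x) i)"
      using cont[of i] by (rule continuous_on_cong[THEN iffD1, rotated -1]) (simp_all add: F)
  qed
  have derF: "(f has_derivative blinfun_apply (F x)) (at x)" if "x \<in> U" for x
    using der F that by simp
  obtain U' V g g' where R: "open U'" "U' \<subseteq> U" "x0 \<in> U'" "open V" "f x0 \<in> V" "homeomorphism U' V f g"
    "\<And>y. y \<in> V \<Longrightarrow> (g has_derivative (g' y)) (at y)"
    "\<And>y. y \<in> V \<Longrightarrow> g' y = inv (blinfun_apply (F (g y)))"
    "\<And>y. y \<in> V \<Longrightarrow> bij (blinfun_apply (F (g y)))"
    using inverse_function_theorem[OF U(1) derF contF U(2) inv] by metis
  have gV: "g y \<in> U" if "y \<in> V" for y
    using R(2,6) that by (auto simp: homeomorphism_def)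
  have ling: "Vector_Spaces.linear (*s) (*s) (g' y)" if "y \<in> V" for y
  proof -
    have eq: "g' y = inv (f' (g y))" and bij: "bij (f' (g y))"
      using R(8,9)[OF that] F[OF gV[OF that]] by auto
    interpret L: Vector_Spaces.linear "(*s)" "(*s)" "f' (g y)"
      by (rule lin[OF gV[OF that]])
    note s = bij_is_surj[OF bij, THEN surj_f_inv_f] and i = bij_is_inj[OF bij, THEN inv_f_f]
    show ?thesis unfolding eq
    proof unfold_locales
      show "inv (f' (g y)) (a + b) = inv (f' (g y)) a + inv (f' (g y)) b" for a b
        using i[of "inv (f' (g y)) a + inv (f' (g y)) b"] by (simp add: L.add s)
      show "inv (f' (g y)) (r *s a) = r *s inv (f' (g y)) a" for r a
        using i[of "r *s inv (f' (g y)) a"] by (simp add: L.scale s)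
    qed
  qed
  have hf: "holomorphic_map_on f U'" unfolding holomorphic_map_on_def using der lin R(2) by blast
  have hg: "holomorphic_map_on g V" unfolding holomorphic_map_on_def using R(7) ling by blast
  show ?thesis
    using that[OF R(3,2)] hf hg R(1,4,6) unfolding biholomorphic_def homeomorphism_def by blast
qed

subsection \<open>Block diagonal matrices near a diagonal matrix\<close>

text \<open>Gershgorin localizes the eigenvalues of the diagonal block labelled \<open>m\<close> near \<open>c m\<close>, so distinct
  blocks have disjoint spectra; as there are only as many eigenvalues as blocks, each block has
  just one.\<close>

lemma block_diagonal_near_diag_rigid:
  fixes B T :: "complex^'n^'n" and b b' :: "'n \<Rightarrow> nat" and c c' :: "nat \<Rightarrow> complex"
  assumes b: "range b = {1..I}" and b': "range b' = {1..I}"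
    and block: "\<And>i j. b i \<noteq> b j \<Longrightarrow> B $ i $ j = 0"
    and near: "\<And>i j. norm (B $ i $ j - diag_mat (c \<circ> b) $ i $ j) \<le> \<delta>"
    and gap: "\<And>m m'. m \<in> {1..I} \<Longrightarrow> m' \<in> {1..I} \<Longrightarrow> m \<noteq> m' \<Longrightarrow> 2 * (real CARD('n) * \<delta>) < norm (c m - c m')"
    and T: "invertible T" and BT: "B ** T = T ** diag_mat (c' \<circ> b')"
  obtains a where "B = diag_mat (a \<circ> b)"
proof -
  \<comment> \<open>Column \<open>j\<close> of \<open>T\<close> is an eigenvector of
    \<open>B\<close> with eigenvalue \<open>c' (b' j)\<close>.\<close>
  have BT_nth: "(\<Sum>l\<in>UNIV. B $ i $ l * T $ l $ j) = c' (b' j) * T $ i $ j" for i j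
    using arg_cong[OF BT, of "\<lambda>M. M $ i $ j"]
    by (simp add: mult_diag_mat_nth mult.commute[of _ "c' (b' j)"]) (simp add: matrix_matrix_mult_def)
  have loc: "norm (c' (b' j) - c (b i)) \<le> real CARD('n) * \<delta>" if "T $ i $ j \<noteq> 0" for i j
  proof -
    define C where "C = {l. b l = b i}"
    have C: "finite C" "i \<in> C" by (auto simp: C_def)
    \<comment> \<open>As \<open>B\<close> is block diagonal, the part of column \<open>j\<close>
      inside the block \<open>C\<close> of \<open>i\<close> satisfies the eigenvector equation by
      itself. The Gershgorin estimate is made in the row \<open>i0\<close> of its largest
      entry.\<close>
    obtain i0 where i0: "i0 \<in> C" "\<And>l. l \<in> C \<Longrightarrow> norm (T $ l $ j) \<le> norm (T $ i0 $ j)"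
    proof -
      have "Max ((\<lambda>l. norm (T $ l $ j)) ` C) \<in> (\<lambda>l. norm (T $ l $ j)) ` C"
        using C by (intro Max_in) auto
      then obtain i0 where "i0 \<in> C" "norm (T $ i0 $ j) = Max ((\<lambda>l. norm (T $ l $ j)) ` C)"
        by auto
      then show ?thesis using that C(1) by simp
    qed
    have pos: "norm (T $ i0 $ j) > 0" using i0(2)[OF C(2)] that
      by auto
    have "(c' (b' j) - c (b i)) * T $ i0 $ j
        = (\<Sum>l\<in>UNIV. (B $ i0 $ l - diag_mat (c \<circ> b) $ i0 $ l) * T $ l $ j)"
    proof -
      have "(\<Sum>l\<in>UNIV. diag_mat (c \<circ> b) $ i0 $ l * T $ l $ j) = c (b i) * T $ i0 $ j"
        using diag_mat_mult_nth[of "c \<circ> b" T i0 j] i0(1)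
        by (simp add: matrix_matrix_mult_def C_def)
      then show ?thesis
        by (simp add: left_diff_distrib sum_subtractf BT_nth del: diag_mat_nth)
    qed
    also have "norm \<dots> \<le> (\<Sum>l\<in>(UNIV :: 'n set). \<delta> * norm (T $ i0 $ j))"
    proof (rule sum_norm_le)
      fix l
      show "norm ((B $ i0 $ l - diag_mat (c \<circ> b) $ i0 $ l) * T $ l $ j) \<le> \<delta> * norm (T $ i0 $ j)"
      proof (cases "l \<in> C")
        case True
        have "0 \<le> \<delta>" using near[of i0 l] norm_ge_zero order_trans by blast
        then show ?thesis
          unfolding norm_mult using near[of i0 l] i0(2)[OF True] by (intro mult_mono) auto
      next
        case False
        then have "B $ i0 $ l = 0" "i0 \<noteq> l" using i0(1) block[of i0 l] by (auto simp: C_def)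
        moreover have "0 \<le> \<delta>" using near[of i0 l] norm_ge_zero order_trans by blast
        ultimately show ?thesis by simp
      qed
    qed
    finally have "norm (c' (b' j) - c (b i)) * norm (T $ i0 $ j) \<le> real CARD('n) * \<delta> * norm (T $ i0 $ j)"
      by (simp add: norm_mult)
    then show ?thesis using pos by simp
  qed
  \<comment> \<open>Columns with a common eigenvalue cannot meet two blocks, since the two values of
    \<open>c\<close> would both lie within less than half their distance of it.\<close>
  have disj: "b i = b i'" if "T $ i $ j \<noteq> 0" "T $ i' $ j' \<noteq> 0" "c' (b' j) = c' (b' j')" for i j i' j'
  proof (rule ccontr)
    assume "b i \<noteq> b i'"
    then have "2 * (real CARD('n) * \<delta>) < norm (c (b i) - c (b i'))"
      using b by (intro gap) auto
    also have "\<dots> \<le> norm (c' (b' j) - c (b i)) + norm (c' (b' j) - c (b i'))"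
      using norm_triangle_ineq4[of "c' (b' j) - c (b i')" "c' (b' j) - c (b i)"] by simp
    finally show False using loc[OF that(1)] loc[OF that(2)] that(3) by simp
  qed
  \<comment> \<open>No row of an invertible matrix vanishes, so every block meets some column;
    \<open>\<sigma> m\<close> will be an eigenvalue found in this way.\<close>
  have "\<exists>x. \<exists>i j. b i = m \<and> T $ i $ j \<noteq> 0 \<and> x = c' (b' j)" if "m \<in> {1..I}" for m
  proof -
    have "m \<in> range b" using b that by simp
    then obtain i where i: "b i = m" by auto
    have "(T ** matrix_inv T) $ i $ i \<noteq> 0"
      by (simp add: matrix_inv_mult[OF T] mat_def)
    then have "(\<Sum>j\<in>UNIV. T $ i $ j * matrix_inv T $ j $ i) \<noteq> 0"
      by (simp add: matrix_matrix_mult_def)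
    then obtain j where "T $ i $ j \<noteq> 0"
      by (metis (no_types, lifting) mult_zero_left sum.neutral)
    then show ?thesis using i by blast
  qed
  then obtain \<sigma> where \<sigma>: "\<And>m. m \<in> {1..I} \<Longrightarrow> \<exists>i j. b i = m \<and> T $ i $ j \<noteq> 0 \<and> \<sigma> m = c' (b' j)"
    by metis
  have inj: "inj_on \<sigma> {1..I}"
  proof (rule inj_onI)
    fix m m' assume m: "m \<in> {1..I}" "m' \<in> {1..I}" "\<sigma> m = \<sigma> m'"
    from \<sigma>[OF m(1)] \<sigma>[OF m(2)] m(3) disj show "m = m'" by metis
  qed
  \<comment> \<open>The \<open>I\<close> distinct values of \<open>\<sigma>\<close> lie among at
    most \<open>I\<close> eigenvalues and therefore exhaust them.\<close>
  have im: "\<sigma> ` {1..I} = c' ` {1..I}"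
  proof (rule card_seteq)
    show "\<sigma> ` {1..I} \<subseteq> c' ` {1..I}"
    proof
      fix x assume "x \<in> \<sigma> ` {1..I}"
      then obtain j where "x = c' (b' j)" using \<sigma> by blast
      then show "x \<in> c' ` {1..I}" using b' by auto
    qed
    show "card (c' ` {1..I}) \<le> card (\<sigma> ` {1..I})"
      unfolding card_image[OF inj] by (rule card_image_le) simp
  qed simp
  have eig: "c' (b' j) = \<sigma> (b i)" if "T $ i $ j \<noteq> 0" for i j
  proof -
    have "c' (b' j) \<in> \<sigma> ` {1..I}" using im b' by auto
    then obtain m where m: "m \<in> {1..I}" "c' (b' j) = \<sigma> m" by auto
    then obtain i' j' where "b i' = m" "T $ i' $ j' \<noteq> 0" "\<sigma> m = c' (b' j')" using \<sigma> by blast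
    then show ?thesis using disj[OF that, of i' j'] m by simp
  qed
  \<comment> \<open>An entry where \<open>T\<close> vanishes gives 0 on both sides, and at the
    others \<open>eig\<close> applies. Cancelling \<open>T\<close> then shows that \<open>B\<close>
    is scalar on each block.\<close>
  have "B ** T = diag_mat (\<sigma> \<circ> b) ** T"
    unfolding BT by (simp add: vec_eq_iff mult_diag_mat_nth diag_mat_mult_nth) (use eig in auto)
  then have "B ** T ** matrix_inv T = diag_mat (\<sigma> \<circ> b) ** T ** matrix_inv T" by simp
  then have "B = diag_mat (\<sigma> \<circ> b)"
    by (simp add: matrix_inv_mult[OF T] flip: matrix_mul_assoc)
  then show ?thesis by (rule that)
qed

section \<open>The linear model of the set in chart coordinates, and its dimension\<close>

definition block_scalar :: "('n::finite \<Rightarrow> nat) \<Rightarrow> (complex^('n \<times> 'n)) set" where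
  "block_scalar b = {Y. \<exists>a. \<forall>i j. b i = b j \<longrightarrow> Y $ (i, j) = (if i = j then a (b i) else 0)}"

lemma linear_vecI:
  fixes f :: "'a::field^'m \<Rightarrow> 'a^'k"
  assumes "\<And>x y. f (x + y) = f x + f y" "\<And>r x. f (r *s x) = r *s f x"
  shows "Vector_Spaces.linear (*s) (*s) f"
  by unfold_locales (rule assms)+

lemma subspace_block_scalar: "vec.subspace (block_scalar b)"
  unfolding vec.subspace_def
proof (intro conjI ballI allI)
  show "0 \<in> block_scalar b" by (auto simp: block_scalar_def intro!: exI[of _ "\<lambda>_. 0"])
next
  fix x y assume "x \<in> block_scalar b" "y \<in> block_scalar b"
  then obtain a a' where
    "\<And>i j. b i = b j \<Longrightarrow> x $ (i, j) = (if i = j then a (b i) else 0)"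
    "\<And>i j. b i = b j \<Longrightarrow> y $ (i, j) = (if i = j then a' (b i) else 0)"
    unfolding block_scalar_def by blast
  then show "x + y \<in> block_scalar b"
    by (auto simp: block_scalar_def intro!: exI[of _ "\<lambda>m. a m + a' m"])
next
  fix r x assume "x \<in> block_scalar b"
  then obtain a where "\<And>i j. b i = b j \<Longrightarrow> x $ (i, j) = (if i = j then a (b i) else 0)"
    unfolding block_scalar_def by blast
  then show "r *s x \<in> block_scalar b"
    by (auto simp: block_scalar_def intro!: exI[of _ "\<lambda>m. r * a m"])
qed

lemma card_same_label:
  assumes b: "labelling I k (b :: 'n::finite \<Rightarrow> nat)"
  shows "card {p. b (fst p) = b (snd p)} = (\<Sum>m=1..I. k m ^ 2)"
proof -
  have "{p. b (fst p) = b (snd p)} = (\<Union>m\<in>{1..I}. (b -` {m}) \<times> (b -` {m}))"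
    using b by (force simp: labelling_def)
  also have "card \<dots> = (\<Sum>m=1..I. card ((b -` {m}) \<times> (b -` {m})))"
    by (rule card_UN_disjoint) auto
  also have "\<dots> = (\<Sum>m=1..I. k m ^ 2)"
    using b by (intro sum.cong) (auto simp: labelling_def card_cartesian_product power2_eq_square)
  finally show ?thesis .
qed

text \<open>The coordinate subspace \<open>E\<close> parametrises the model: it has one coordinate
  for each entry off the blocks and, for each label \<open>m\<close>, one at a chosen diagonal
  position \<open>(r m, r m)\<close>, whose value \<open>h\<close> spreads along the diagonal of the
  block. The additive form avoids truncated subtraction.\<close>

lemma dim_block_scalar:
  assumes b: "labelling I k (b :: 'n::finite \<Rightarrow> nat)"
  shows "vec.dim (block_scalar b) + (\<Sum>m=1..I. k m ^ 2) = CARD('n) ^ 2 + I"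
proof -
  have "\<exists>r. \<forall>m\<in>{1..I}. b (r m) = m"
  proof (rule bchoice, rule ballI)
    fix m assume "m \<in> {1..I}"
    then have "m \<in> range b" using b by (simp add: labelling_def)
    then show "\<exists>i. b i = m" by auto
  qed
  then obtain r where r: "\<And>m. m \<in> {1..I} \<Longrightarrow> b (r m) = m" by blast
  have bI: "b i \<in> {1..I}" for i using b by (auto simp: labelling_def)
  define D where "D = {p. b (fst p) \<noteq> b (snd p)} \<union> (\<lambda>m. (r m, r m)) ` {1..I}"
  define E where "E = {Y :: complex^('n \<times> 'n). \<forall>p. p \<notin> D \<longrightarrow> Y $ p = 0}"
  define h :: "complex^('n \<times> 'n) \<Rightarrow> complex^('n \<times> 'n)" where
    "h Y = (\<chi> p. if b (fst p) \<noteq> b (snd p) then Y $ p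
        else if fst p = snd p then Y $ (r (b (fst p)), r (b (fst p))) else 0)" for Y
  have lin: "Vector_Spaces.linear (*s) (*s) h"
    by (rule linear_vecI) (simp_all add: h_def vec_eq_iff)
  have E: "vec.subspace E"
    unfolding E_def vec.subspace_def by simp
  have inj: "inj_on h (vec.span E)"
  proof -
    have "inj_on h E"
    proof (rule inj_onI)
      fix Y Z assume YZ: "Y \<in> E" "Z \<in> E" "h Y = h Z"
      then have eq: "h Y $ p = h Z $ p" for p by simp
      have "Y $ p = Z $ p" for p
      proof (cases "p \<in> D")
        case False
        then show ?thesis using YZ by (cases p) (simp add: E_def)
      next
        case True
        then show ?thesis using eq[of p] r by (auto simp: D_def h_def)
      qed
      then show "Y = Z" by (simp add: vec_eq_iff)
    qed
    then show ?thesis using E by (simp add: vec.span_eq_iff[THEN iffD2])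
  qed
  have im: "h ` E = block_scalar b"
  proof
    show "h ` E \<subseteq> block_scalar b"
    proof
      fix Z assume "Z \<in> h ` E"
      then obtain Y where "Z = h Y" by auto
      then show "Z \<in> block_scalar b"
        unfolding block_scalar_def by (auto simp: h_def intro!: exI[of _ "\<lambda>m. Y $ (r m, r m)"])
    qed
    show "block_scalar b \<subseteq> h ` E"
    proof
      fix Z :: "complex^('n \<times> 'n)" assume "Z \<in> block_scalar b"
      then obtain a where a: "\<And>i j. b i = b j \<Longrightarrow> Z $ (i, j) = (if i = j then a (b i) else 0)"
        unfolding block_scalar_def by blast
      define Y where "Y = (\<chi> p. if p \<in> D then Z $ p else 0)"
      have "Y \<in> E" by (simp add: Y_def E_def)
      moreover have "h Y = Z"
      proof -
        have "h Y $ (i, j) = Z $ (i, j)" for i j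
        proof (cases "b i = b j")
          case True
          have "(r (b i), r (b i)) \<in> D" using bI by (auto simp: D_def)
          then show ?thesis using True a r[OF bI] by (simp add: h_def Y_def)
        next
          case False
          then show ?thesis by (simp add: h_def Y_def D_def)
        qed
        then show ?thesis by (simp add: vec_eq_iff)
      qed
      ultimately show "Z \<in> h ` E" by blast
    qed
  qed
  have "vec.dim (block_scalar b) = vec.dim E"
    using vec.dim_image_eq[OF lin inj] im by simp
  also have "\<dots> = card D" unfolding E_def by (rule dim_substandard_cart)
  also have "card D = card {p. b (fst p) \<noteq> b (snd p)} + I"
  proof -
    have "inj_on (\<lambda>m. (r m, r m)) {1..I}" using r by (auto intro!: inj_onI) metis
    then have "card ((\<lambda>m. (r m, r m)) ` {1..I}) = I" by (simp add: card_image)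
    then show ?thesis unfolding D_def by (subst card_Un_disjoint) auto
  qed
  finally have 1: "vec.dim (block_scalar b) = card {p. b (fst p) \<noteq> b (snd p)} + I" .
  have "card {p. b (fst p) \<noteq> b (snd p)} + card {p. b (fst p) = b (snd p)} = CARD('n \<times> 'n)"
  proof (subst card_Un_disjoint[symmetric])
    have "{p. b (fst p) \<noteq> b (snd p)} \<union> {p. b (fst p) = b (snd p)} = UNIV" by auto
    then show "card ({p. b (fst p) \<noteq> b (snd p)} \<union> {p. b (fst p) = b (snd p)}) = CARD('n \<times> 'n)"
      by simp
  qed auto
  then show ?thesis using 1 card_same_label[OF b] by (simp add: power2_eq_square)
qed

subsection \<open>The chart\<close>

text \<open>Complex scaling of matrices; at this type \<open>*s\<close> would take its scalar from
  \<open>complex^'n\<close>.\<close>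

definition smult_mat :: "complex \<Rightarrow> complex^'n^'m \<Rightarrow> complex^'n^'m" where
  "smult_mat r A = (\<chi> i j. r * A $ i $ j)"

lemma smult_mat_simps:
  "smult_mat r M ** N = smult_mat r (M ** N)"
  "M ** smult_mat r N = smult_mat r (M ** N)"
  "smult_mat r M + smult_mat r M' = smult_mat r (M + M')"
  "- smult_mat r M = smult_mat r (- M)"
  by (simp_all add: smult_mat_def vec_eq_iff matrix_matrix_mult_def sum_distrib_left algebra_simps)

lemma mat_to_vec_nth [simp]: "mat_to_vec A $ (i, j) = A $ i $ j"
  by (simp add: mat_to_vec_def)

lemma mat_to_vec_eq_iff [simp]: "mat_to_vec A = mat_to_vec B \<longleftrightarrow> A = B"
  by (auto simp: vec_eq_iff)

lemma mat_to_vec_add: "mat_to_vec (A + B) = mat_to_vec A + mat_to_vec B"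
  by (simp add: vec_eq_iff)

lemma mat_to_vec_smult: "mat_to_vec (smult_mat r A) = r *s mat_to_vec A"
  by (simp add: vec_eq_iff smult_mat_def)

lemma bounded_linear_mat_to_vec: "bounded_linear mat_to_vec"
  unfolding linear_conv_bounded_linear[symmetric] by (rule linearI) (simp_all add: vec_eq_iff)

definition block_part :: "('n::finite \<Rightarrow> nat) \<Rightarrow> complex^('n \<times> 'n) \<Rightarrow> complex^'n^'n" where
  "block_part b Y = (\<chi> i j. if b i = b j then Y $ (i, j) else 0)"

definition off_block_part :: "('n::finite \<Rightarrow> nat) \<Rightarrow> complex^('n \<times> 'n) \<Rightarrow> complex^'n^'n" where
  "off_block_part b Y = (\<chi> i j. if b i = b j then 0 else Y $ (i, j))"

lemma part_simps:
  "block_part b (x + y) = block_part b x + block_part b y"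
  "off_block_part b (x + y) = off_block_part b x + off_block_part b y"
  "block_part b (r *s x) = smult_mat r (block_part b x)"
  "off_block_part b (r *s x) = smult_mat r (off_block_part b x)"
  by (simp_all add: block_part_def off_block_part_def smult_mat_def vec_eq_iff)

lemma bounded_linear_block_part: "bounded_linear (block_part b)"
  and bounded_linear_off_block_part: "bounded_linear (off_block_part b)"
  unfolding linear_conv_bounded_linear[symmetric]
  by (rule linearI, simp_all add: block_part_def off_block_part_def vec_eq_iff)+

lemma mem_block_scalar_iff: "Y \<in> block_scalar b \<longleftrightarrow> (\<exists>a. block_part b Y = diag_mat (a \<circ> b))"
  unfolding block_scalar_def mem_Collect_eq
  by (rule iff_exI) (auto simp: block_part_def vec_eq_iff)

text \<open>A matrix close to \<open>diag_mat (c \<circ> b)\<close>, with \<open>c\<close> injective, is conjugate to a block diagonal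
  matrix \<open>B\<close> by exactly one small perturbation \<open>1 + X\<close> of the identity with \<open>X\<close> vanishing on the
  blocks. The vector \<open>Y\<close> packs \<open>B\<close> and \<open>X\<close> into complementary entries.\<close>

definition chart_conj :: "complex^'n^'n \<Rightarrow> ('n::finite \<Rightarrow> nat) \<Rightarrow> complex^('n \<times> 'n) \<Rightarrow> complex^'n^'n" where
  "chart_conj T b Y = T + T ** off_block_part b Y"

definition chart_map :: "complex^'n^'n \<Rightarrow> ('n::finite \<Rightarrow> nat) \<Rightarrow> complex^('n \<times> 'n) \<Rightarrow> complex^'n^'n" where
  "chart_map T b Y = chart_conj T b Y ** block_part b Y ** matrix_inv (chart_conj T b Y)"

text \<open>The product rule for a conjugation, left unsimplified and taken at an arbitrary base
  point, so that linearity in \<open>h\<close> and continuity in \<open>Y\<close> can be read off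
  term by term.\<close>

definition chart_deriv ::
  "complex^'n^'n \<Rightarrow> ('n::finite \<Rightarrow> nat) \<Rightarrow> complex^('n \<times> 'n) \<Rightarrow> complex^('n \<times> 'n) \<Rightarrow> complex^'n^'n" where
  "chart_deriv T b Y h = (let S = chart_conj T b Y; B = block_part b Y; Q = matrix_inv S in
     S ** B ** - (Q ** (T ** off_block_part b h) ** Q) +
     (S ** block_part b h + T ** off_block_part b h ** B) ** Q)"

lemma has_derivative_chart_map:
  assumes "invertible (chart_conj T b Y)"
  shows "(chart_map T b has_derivative chart_deriv T b Y) (at Y)"
proof -
  have "((\<lambda>Y. T ** off_block_part b Y) has_derivative (\<lambda>h. T ** off_block_part b h)) (at Y)"
    by (intro bounded_linear.has_derivative[OF matrix_mult.bounded_linear_right]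
        bounded_linear_imp_has_derivative bounded_linear_off_block_part)
  then have "(chart_conj T b has_derivative (\<lambda>h. T ** off_block_part b h)) (at Y)"
    using has_derivative_add[OF has_derivative_const[of T]] by (fastforce simp: chart_conj_def[abs_def])
  from has_derivative_conjugate[OF this bounded_linear_imp_has_derivative[OF bounded_linear_block_part[of b]] assms]
  show ?thesis by (simp add: chart_map_def[abs_def] chart_deriv_def[abs_def] Let_def)
qed

lemma linear_chart_deriv:
  "Vector_Spaces.linear (*s) (*s) (\<lambda>h. mat_to_vec (chart_deriv T b Y h))"
proof (rule linear_vecI)
  show "mat_to_vec (chart_deriv T b Y (x + y)) =
      mat_to_vec (chart_deriv T b Y x) + mat_to_vec (chart_deriv T b Y y)" for x y
    by (simp add: chart_deriv_def Let_def part_simps matrix_mult.add_left matrix_mult.add_right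
        matrix_mult.minus_right matrix_mult.minus_left matrix_mult.diff_right algebra_simps flip: mat_to_vec_add)
  show "mat_to_vec (chart_deriv T b Y (r *s x)) = r *s mat_to_vec (chart_deriv T b Y x)" for r x
    by (simp add: chart_deriv_def Let_def part_simps smult_mat_simps flip: mat_to_vec_smult)
qed

lemma continuous_on_chart_conj: "continuous_on S (chart_conj T b)"
  unfolding chart_conj_def[abs_def]
  by (intro continuous_intros matrix_mult.continuous_on
      linear_continuous_on[OF bounded_linear_off_block_part])

lemma continuous_on_chart_deriv:
  assumes "\<And>Y. Y \<in> S \<Longrightarrow> invertible (chart_conj T b Y)"
  shows "continuous_on S (\<lambda>Y. chart_deriv T b Y h)"
proof -
  have "continuous_on S (\<lambda>Y. matrix_inv (chart_conj T b Y))"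
    using assms by (intro continuous_on_compose2[OF continuous_on_matrix_inv continuous_on_chart_conj]) auto
  then show ?thesis
    unfolding chart_deriv_def Let_def
    by (intro continuous_intros matrix_mult.continuous_on continuous_on_chart_conj
        linear_continuous_on[OF bounded_linear_block_part])
qed

lemma chart_conj_diag [simp]: "chart_conj T b (mat_to_vec (diag_mat d)) = T"
  and block_part_diag [simp]: "block_part b (mat_to_vec (diag_mat d)) = diag_mat d"
proof -
  have "off_block_part b (mat_to_vec (diag_mat d)) = 0"
    by (simp add: off_block_part_def vec_eq_iff)
  then show "chart_conj T b (mat_to_vec (diag_mat d)) = T"
    by (simp add: chart_conj_def matrix_mult.zero_right)
  show "block_part b (mat_to_vec (diag_mat d)) = diag_mat d"
    by (simp add: block_part_def vec_eq_iff)
qed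

text \<open>Undoing the conjugation by \<open>T\<close> leaves
  \<open>H + X ** \<Lambda> - \<Lambda> ** X = 0\<close>. On the blocks \<open>X\<close> vanishes,
  which forces \<open>H = 0\<close>; off the blocks \<open>H\<close> vanishes and each entry of
  \<open>X\<close> is multiplied by \<open>c (b j) - c (b i)\<close>, which is nonzero.\<close>

lemma chart_deriv_inj:
  assumes T: "invertible T" and c: "\<And>i j. c (b i) = c (b j) \<Longrightarrow> b i = b j"
    and 0: "chart_deriv T b (mat_to_vec (diag_mat (c \<circ> b))) h = 0"
  shows "h = 0"
proof -
  define \<Lambda> Q X H where "\<Lambda> = diag_mat (c \<circ> b)" and "Q = matrix_inv T"
    and "X = off_block_part b h" and "H = block_part b h"
  have QT: "Q ** T = mat 1" unfolding Q_def by (rule matrix_inv_mult[OF T])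
  have "T ** \<Lambda> ** - (Q ** (T ** X) ** Q) + (T ** H + T ** X ** \<Lambda>) ** Q = 0"
    using 0 by (simp add: chart_deriv_def Let_def \<Lambda>_def Q_def X_def H_def)
  then have "Q ** (T ** \<Lambda> ** - (Q ** (T ** X) ** Q) + (T ** H + T ** X ** \<Lambda>) ** Q) ** T = 0"
    by (simp add: matrix_mult.zero_left matrix_mult.zero_right)
  moreover have QTM: "Q ** (T ** M) = M" for M
    by (simp add: matrix_mul_assoc QT)
  ultimately have eq: "- (\<Lambda> ** X) + (H + X ** \<Lambda>) = 0"
    by (simp add: matrix_mult.add_left matrix_mult.add_right matrix_mult.minus_left
        matrix_mult.minus_right matrix_mult.diff_left matrix_mult.diff_right QT QTM flip: matrix_mul_assoc)
  have "h $ (i, j) = 0" for i j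
  proof (cases "b i = b j")
    case True
    then show ?thesis using arg_cong[OF eq, of "\<lambda>M. M $ i $ j"]
      by (simp add: \<Lambda>_def diag_mat_mult_nth mult_diag_mat_nth X_def H_def off_block_part_def block_part_def)
  next
    case False
    have "h $ (i, j) * (c (b j) - c (b i)) = 0"
      using False arg_cong[OF eq, of "\<lambda>M. M $ i $ j"]
      by (simp add: \<Lambda>_def diag_mat_mult_nth mult_diag_mat_nth X_def H_def off_block_part_def
          block_part_def algebra_simps)
    then show ?thesis using False c by auto
  qed
  then show ?thesis by (simp add: vec_eq_iff)
qed

text \<open>From left to right, an eigenbasis of the image is transported back to one of the block
  diagonal matrix, where Gershgorin rigidity applies. From right to left, the scalars on the blocks
  are close to the values of \<open>c\<close>, hence still distinct, and
  \<open>chart_conj T b Y\<close> itself diagonalizes the image.\<close>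

lemma chart_map_mem_iff:
  fixes T :: "complex^'n^'n"
  assumes b: "labelling I k b" and S: "invertible (chart_conj T b Y)"
    and near: "norm (block_part b Y - diag_mat (c \<circ> b)) \<le> \<delta>"
    and gap: "\<And>m m'. m \<in> {1..I} \<Longrightarrow> m' \<in> {1..I} \<Longrightarrow> m \<noteq> m' \<Longrightarrow> 2 * (real CARD('n) * \<delta>) < norm (c m - c m')"
  shows "chart_map T b Y \<in> diagonalizable_mult I k \<longleftrightarrow> Y \<in> block_scalar b"
proof
  have rb: "range b = {1..I}" using b by (simp add: labelling_def)
  have near': "norm (block_part b Y $ i $ j - diag_mat (c \<circ> b) $ i $ j) \<le> \<delta>" for i j
    using order_trans[OF Finite_Cartesian_Product.norm_nth_le order_trans[OF Finite_Cartesian_Product.norm_nth_le near]]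
    by (metis vector_minus_component)
  let ?S = "chart_conj T b Y" and ?B = "block_part b Y"
  have A: "chart_map T b Y = ?S ** ?B ** matrix_inv ?S" by (simp add: chart_map_def)
  {
    assume "chart_map T b Y \<in> diagonalizable_mult I k"
    then obtain T' :: "complex^'n^'n" and b' c' where T': "invertible T'" and b': "labelling I k b'"
      and A': "chart_map T b Y = T' ** diag_mat (c' \<circ> b') ** matrix_inv T'"
      unfolding diagonalizable_mult_iff by blast
    have AT': "chart_map T b Y ** T' = T' ** diag_mat (c' \<circ> b')"
      using A' eq_conjugate_iff[OF T'] by blast
    have "matrix_inv ?S ** chart_map T b Y = ?B ** matrix_inv ?S"
      unfolding A by (simp add: matrix_mul_assoc matrix_inv_mult[OF S])
    then have "?B ** matrix_inv ?S ** T' = matrix_inv ?S ** (chart_map T b Y ** T')"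
      by (simp add: matrix_mul_assoc)
    then have "?B ** (matrix_inv ?S ** T') = matrix_inv ?S ** T' ** diag_mat (c' \<circ> b')"
      by (simp add: AT' matrix_mul_assoc)
    moreover have "invertible (matrix_inv ?S ** T')"
      using S T' by (intro invertible_mult invertible_matrix_inv)
    moreover have "range b' = {1..I}" using b' by (simp add: labelling_def)
    ultimately obtain a where "?B = diag_mat (a \<circ> b)"
      using block_diagonal_near_diag_rigid[OF rb _ _ near' gap, of b' "matrix_inv ?S ** T'" c']
      by (auto simp: block_part_def)
    then show "Y \<in> block_scalar b" unfolding mem_block_scalar_iff by blast
  }
  {
    assume "Y \<in> block_scalar b"
    then obtain a where a: "?B = diag_mat (a \<circ> b)" unfolding mem_block_scalar_iff by blast
    have \<delta>: "0 \<le> \<delta>" using near norm_ge_zero order_trans by blast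
    have ac: "norm (a m - c m) \<le> \<delta>" if m: "m \<in> {1..I}" for m
    proof -
      have "m \<in> range b" using m rb by simp
      then obtain i where "m = b i" by auto
      then show ?thesis using near'[of i i] by (simp add: a)
    qed
    have "inj_on a {1..I}"
    proof (rule inj_onI, rule ccontr)
      fix m m' assume m: "m \<in> {1..I}" "m' \<in> {1..I}" "a m = a m'" "m \<noteq> m'"
      have "norm (c m - c m') \<le> norm (a m - c m) + norm (a m' - c m')"
        using norm_triangle_ineq4[of "a m' - c m'" "a m - c m"] m(3) by simp
      also have "\<dots> \<le> 2 * \<delta>" using ac[OF m(1)] ac[OF m(2)] by simp
      \<comment> \<open>Index types are nonempty, so \<open>CARD('n)\<close> is at least 1.\<close>
      also have "\<dots> \<le> 2 * (real CARD('n) * \<delta>)"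
        using \<delta> by (simp add: mult_le_cancel_right1 Suc_le_eq)
      finally show False using gap[OF m(1,2,4)] by simp
    qed
    then show "chart_map T b Y \<in> diagonalizable_mult I k"
      unfolding diagonalizable_mult_iff using S b A a by auto
  }
qed

section \<open>From local charts to the dimension\<close>

lemma uniform_gap:
  fixes c :: "nat \<Rightarrow> 'a::real_normed_vector"
  assumes "inj_on c {1..I}" "K > 0"
  obtains \<delta> where "\<delta> > 0"
    "\<And>m m'. m \<in> {1..I} \<Longrightarrow> m' \<in> {1..I} \<Longrightarrow> m \<noteq> m' \<Longrightarrow> K * \<delta> < norm (c m - c m')"
proof -
  \<comment> \<open>The extra element 1 keeps the minimum defined when there are no two distinct
    indices; halving the minimum below makes the bound strict.\<close>
  define P where "P = insert 1 ((\<lambda>(m, m'). norm (c m - c m')) ` {(m, m') \<in> {1..I} \<times> {1..I}. m \<noteq> m'})"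
  have "finite {(m, m') \<in> {1..I} \<times> {1..I}. m \<noteq> m'}"
    by (rule finite_subset[of _ "{1..I} \<times> {1..I}"]) auto
  then have P: "finite P" "P \<noteq> {}" by (auto simp: P_def)
  have "c m \<noteq> c m'" if "m \<in> {1..I}" "m' \<in> {1..I}" "m \<noteq> m'" for m m'
    using inj_on_contraD[OF assms(1) that(3,1,2)] .
  then have "\<forall>x\<in>P. 0 < x" by (auto simp: P_def)
  then have pos: "Min P > 0" using P by simp
  have "K * (Min P / (2 * K)) < norm (c m - c m')"
    if "m \<in> {1..I}" "m' \<in> {1..I}" "m \<noteq> m'" for m m'
  proof -
    have "norm (c m - c m') \<in> P" using that by (force simp: P_def)
    then have "Min P \<le> norm (c m - c m')" using P by simp
    then show ?thesis using pos assms(2) by simp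
  qed
  moreover have "Min P / (2 * K) > 0" using pos assms(2) by simp
  ultimately show ?thesis using that by blast
qed

text \<open>Each point brings its own \<open>T\<close>, labelling and eigenvalues, and with them a
  chart. The dimension is the same everywhere, because \<open>dim_block_scalar\<close> involves only
  the block sizes.\<close>

lemma complex_submanifold_diagonalizable_mult:
  assumes dim: "d + (\<Sum>m=1..I. k m ^ 2) = CARD('n) ^ 2 + I"
  shows "complex_submanifold d (mat_to_vec ` (diagonalizable_mult I k :: (complex^'n^'n) set))"
    (is "complex_submanifold d ?D")
  unfolding complex_submanifold_def
proof
  fix p assume "p \<in> ?D"
  then obtain T :: "complex^'n^'n" and b c where T: "invertible T" and b: "labelling I k b"
    and c: "inj_on c {1..I}" and p: "p = mat_to_vec (T ** diag_mat (c \<circ> b) ** matrix_inv T)"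
    by (auto simp: diagonalizable_mult_iff)
  obtain \<delta> where \<delta>: "\<delta> > 0" and gap:
    "\<And>m m'. m \<in> {1..I} \<Longrightarrow> m' \<in> {1..I} \<Longrightarrow> m \<noteq> m' \<Longrightarrow> 2 * real CARD('n) * \<delta> < norm (c m - c m')"
    using uniform_gap[OF c, of "2 * real CARD('n)"] by auto
  \<comment> \<open>\<open>Y0\<close> is the chart centre, with no off-block part; \<open>U\<close>
    is an open neighbourhood of it on which \<open>chart_map_mem_iff\<close> applies.\<close>
  define Y0 where "Y0 = mat_to_vec (diag_mat (c \<circ> b))"
  define U where "U = {Y. invertible (chart_conj T b Y)} \<inter> {Y. norm (block_part b Y - diag_mat (c \<circ> b)) < \<delta>}"
  define f where "f Y = mat_to_vec (chart_map T b Y)" for Y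
  have op: "open U" unfolding U_def
  proof (rule open_Int)
    show "open {Y. invertible (chart_conj T b Y)}"
      using open_vimage[OF open_invertible continuous_on_chart_conj] by (simp add: vimage_def)
    show "open {Y. norm (block_part b Y - diag_mat (c \<circ> b)) < \<delta>}"
      by (intro open_Collect_less continuous_intros linear_continuous_on[OF bounded_linear_block_part])
  qed
  have Y0: "Y0 \<in> U" using T \<delta> by (simp add: U_def Y0_def)
  have der: "(f has_derivative (\<lambda>h. mat_to_vec (chart_deriv T b Y h))) (at Y)" if "Y \<in> U" for Y
    unfolding f_def using that
    by (intro bounded_linear.has_derivative[OF bounded_linear_mat_to_vec] has_derivative_chart_map)
      (simp add: U_def)
  have cont: "continuous_on U (\<lambda>Y. mat_to_vec (chart_deriv T b Y h))" for h
    by (intro bounded_linear.continuous_on[OF bounded_linear_mat_to_vec] continuous_on_chart_deriv)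
      (simp add: U_def)
  have ker: "h = 0" if "mat_to_vec (chart_deriv T b Y0 h) = 0" for h
  proof -
    have "b i \<in> {1..I}" for i using b by (auto simp: labelling_def)
    then have "b i = b j" if "c (b i) = c (b j)" for i j
      using c that by (meson inj_onD)
    moreover have "chart_deriv T b Y0 h = 0"
      using that by (simp add: vec_eq_iff)
    ultimately show ?thesis using chart_deriv_inj[OF T] unfolding Y0_def by blast
  qed
  obtain U' V g where U': "Y0 \<in> U'" "U' \<subseteq> U"
    and bf: "biholomorphic U' V f g" and bg: "biholomorphic V U' g f"
    by (rule holomorphic_inverse_function_theorem[OF op Y0 der linear_chart_deriv cont ker])
  have fU': "f ` U' = V" and gf: "\<And>Y. Y \<in> U' \<Longrightarrow> g (f Y) = Y"
    using bf by (auto simp: biholomorphic_def)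
  have iff: "f Y \<in> ?D \<longleftrightarrow> Y \<in> block_scalar b" if "Y \<in> U'" for Y
  proof -
    have "f Y \<in> ?D \<longleftrightarrow> chart_map T b Y \<in> diagonalizable_mult I k"
      by (auto simp: f_def)
    also have "\<dots> \<longleftrightarrow> Y \<in> block_scalar b"
      using that U' gap by (intro chart_map_mem_iff[OF b, where \<delta> = \<delta> and c = c]) (auto simp: U_def mult.assoc)
    finally show ?thesis .
  qed
  have "f Y0 = p" by (simp add: f_def Y0_def chart_map_def p)
  then have "p \<in> V" using fU' U' by auto
  \<comment> \<open>A straightening leads from the ambient space to the linear model, so it is the
    inverse \<open>g\<close> of the parametrisation \<open>f\<close>.\<close>
  moreover have "g ` (V \<inter> ?D) = U' \<inter> block_scalar b"
  proof -
    have "V \<inter> ?D = f ` (U' \<inter> block_scalar b)"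
      unfolding fU'[symmetric] using iff by auto
    then show ?thesis using gf by (auto simp: image_image)
  qed
  moreover have "vec.dim (block_scalar b) = d" using dim_block_scalar[OF b] dim by simp
  ultimately show "\<exists>U V \<phi> \<psi> (L :: (complex^('n \<times> 'n)) set). p \<in> U \<and> biholomorphic U V \<phi> \<psi> \<and> vec.subspace L \<and> vec.dim L = d \<and>
      \<phi> ` (U \<inter> ?D) = V \<inter> L"
    using bg subspace_block_scalar[of b]
    by blast
qed

theorem corollary1p1:
  fixes I :: nat and k :: "nat \<Rightarrow> nat"
  assumes "\<And>i. i \<in> {1..I} \<Longrightarrow> k i > 0"
    and "(\<Sum>i=1..I. k i) = CARD('n)"
  shows "int (complex_dim (mat_to_vec ` (diagonalizable_mult I k :: (complex^'n^'n) set)))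
           = int CARD('n) ^ 2 - (\<Sum>i=1..I. int (k i) ^ 2) + int I
       \<and> int CARD('n) ^ 2 - (\<Sum>i=1..I. int (k i) ^ 2) + int I
           = int CARD('n) ^ 2 - (\<Sum>i=1..I. int (k i) ^ 2 - 1)"
proof
  let ?D = "mat_to_vec ` (diagonalizable_mult I k :: (complex^'n^'n) set)"
  obtain b :: "'n \<Rightarrow> nat" where b: "labelling I k b"
    using labelling_exists[OF assms] by auto
  \<comment> \<open>The equation for \<open>d\<close> does not mention \<open>b\<close>, so this
    number fits the charts of all labellings.\<close>
  define d where "d = vec.dim (block_scalar b)"
  have d: "d + (\<Sum>m=1..I. k m ^ 2) = CARD('n) ^ 2 + I"
    unfolding d_def by (rule dim_block_scalar[OF b])
  have "complex_dim ?D = d"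
    using complex_dim_submanifold[OF complex_submanifold_diagonalizable_mult[OF d]]
      diagonalizable_mult_nonempty[OF assms] by simp
  moreover have "int d + (\<Sum>m=1..I. int (k m) ^ 2) = int CARD('n) ^ 2 + int I"
    using arg_cong[OF d, of int] by simp
  ultimately show "int (complex_dim ?D) = int CARD('n) ^ 2 - (\<Sum>i=1..I. int (k i) ^ 2) + int I"
    by simp
qed (simp add: sum_subtractf)

end
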